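(* For a fixed expected consolidation cycle length, HP1 with a larger quantity parameter achieves larger average order delay than HP1 with a smaller quantity parameter, and the same holds for HP2. That is, for integers $1\le q<q'$ and reals $T,T'>0$: (1) if $\mathbb{E}[\tau_q\wedge T]=\mathbb{E}[\tau_{q'}\wedge T']$, then the average order delay of HP1 with parameters $(q',T')$ is strictly larger than that of HP1 with parameters $(q,T)$; (2) if $\mathbb{E}[\tau_q\wedge(\tau_1+T)]=\mathbb{E}[\tau_{q'}\wedge(\tau_1+T')]$, then the average order delay of HP2 with parameters $(q',T')$ is strictly larger than that of HP2 with parameters $(q,T)$.
   Context: Customer orders arrive according to a Poisson process $\{N(t)\}_{t\ge 0}$ with rate $\lambda>0$ and $N(0)=0$; $\tau_n$ denotes the arrival time of the $n$-th order, and $a\wedge b=\min(a,b)$. A renewal-type clearing policy is specified by its shipment-release time $\tau$ (the length of one consolidation cycle started at time $0$), a stopping time of the natural filtration of $N$ with $0<\mathbb{E}[\tau]<\infty$. Its expected cycle length is $\mathbb{E}[\tau]$ and its average order delay is $AOD_\tau=\mathbb{E}\left[\int_0^\tau N(u)\,du\right]/(\lambda\,\mathbb{E}[\tau])$. The policies are: HP1 with quantity parameter $q\in\{1,2,\dots\}$ and time parameter $T>0$: $\tau=\tau_q\wedge T$; HP2 with quantity parameter $q\in\{1,2,\dots\}$ and time parameter $T>0$: $\tau=\tau_q\wedge(\tau_1+T)$. *)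

theory Defs
  imports "HOL-Probability.Probability"
begin

text \<open>Time is indexed by \<^typ>\<open>real\<close>; only the values at nonnegative times matter. In the
  increments, subtraction on \<^typ>\<open>nat\<close> does not truncate because the paths are nondecreasing.\<close>

locale poisson_process = prob_space M
  for M :: "'a measure" and lam :: real and N :: "real \<Rightarrow> 'a \<Rightarrow> nat" +
  assumes rate_pos: "0 < lam"
    and random_variable_N: "\<And>t. 0 \<le> t \<Longrightarrow> random_variable (count_space UNIV) (N t)"
    and N_0: "\<And>\<omega>. \<omega> \<in> space M \<Longrightarrow> N 0 \<omega> = 0"
    and mono_path: "\<And>\<omega>. \<omega> \<in> space M \<Longrightarrow> mono_on {0..} (\<lambda>t. N t \<omega>)"
    and right_continuous_path:
      "\<And>\<omega> t. \<omega> \<in> space M \<Longrightarrow> 0 \<le> t \<Longrightarrow> continuous (at_right t) (\<lambda>u. N u \<omega>)"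
    and independent_increments:
      "\<And>(s :: nat \<Rightarrow> real) n. 0 \<le> s 0 \<Longrightarrow> mono_on {..n} s \<Longrightarrow>
         indep_vars (\<lambda>_. count_space UNIV) (\<lambda>i \<omega>. N (s (Suc i)) \<omega> - N (s i) \<omega>) {..<n}"
    and poisson_increments:
      "\<And>s t. 0 \<le> s \<Longrightarrow> s < t \<Longrightarrow>
         distr M (count_space UNIV) (\<lambda>\<omega>. N t \<omega> - N s \<omega>)
           = measure_pmf (poisson_pmf (lam * (t - s)))"

text \<open>Random times take values in \<^typ>\<open>ennreal\<close>, so that the arrival time of an order that never
  arrives (a null event for a Poisson process) is \<open>\<infinity>\<close>, and so that expectations of nonnegative
  quantities are meaningful without integrability side conditions.\<close>

definition arrival_time :: "(real \<Rightarrow> 'a \<Rightarrow> nat) \<Rightarrow> nat \<Rightarrow> 'a \<Rightarrow> ennreal" where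
  "arrival_time N n \<omega> = (INF t \<in> {t. 0 \<le> t \<and> n \<le> N t \<omega>}. ennreal t)"

definition HP1 :: "(real \<Rightarrow> 'a \<Rightarrow> nat) \<Rightarrow> nat \<Rightarrow> real \<Rightarrow> 'a \<Rightarrow> ennreal" where
  "HP1 N q T \<omega> = min (arrival_time N q \<omega>) (ennreal T)"

definition HP2 :: "(real \<Rightarrow> 'a \<Rightarrow> nat) \<Rightarrow> nat \<Rightarrow> real \<Rightarrow> 'a \<Rightarrow> ennreal" where
  "HP2 N q T \<omega> = min (arrival_time N q \<omega>) (arrival_time N 1 \<omega> + ennreal T)"

definition expected_cycle_length :: "'a measure \<Rightarrow> ('a \<Rightarrow> ennreal) \<Rightarrow> ennreal" where
  "expected_cycle_length M \<tau> = (\<integral>\<^sup>+ \<omega>. \<tau> \<omega> \<partial>M)"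

definition cycle_delay :: "(real \<Rightarrow> 'a \<Rightarrow> nat) \<Rightarrow> ('a \<Rightarrow> ennreal) \<Rightarrow> 'a \<Rightarrow> ennreal" where
  "cycle_delay N \<tau> \<omega> =
     (\<integral>\<^sup>+ u \<in> {u. 0 \<le> u \<and> ennreal u \<le> \<tau> \<omega>}. of_nat (N u \<omega>) \<partial>lborel)"

definition average_order_delay ::
  "'a measure \<Rightarrow> real \<Rightarrow> (real \<Rightarrow> 'a \<Rightarrow> nat) \<Rightarrow> ('a \<Rightarrow> ennreal) \<Rightarrow> ennreal" where
  "average_order_delay M lam N \<tau> =
     (\<integral>\<^sup>+ \<omega>. cycle_delay N \<tau> \<omega> \<partial>M) / (ennreal lam * expected_cycle_length M \<tau>)"

end

theory Submission
  imports Defs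
begin

text \<open>
  Write \<open>\<sigma>\<close> for the cycle of the policy with the small quantity parameter \<open>q\<close> and \<open>\<tau>\<close> for the
  cycle of the policy with the large one. Equal mean lengths force \<open>T' < T\<close>: otherwise \<open>\<sigma> \<le> \<tau>\<close> on
  every path, with strict inequality with positive probability. Now compare the two cycles on one
  path. If \<open>\<sigma> < u \<le> \<tau>\<close>, then the clock of the first policy has not run out at time \<open>u\<close>, so \<open>\<sigma>\<close> was
  triggered by the \<open>q\<close>-th order and \<open>N u \<ge> q\<close>. If \<open>\<tau> < u < \<sigma>\<close>, then the \<open>q\<close>-th order is still to
  come and \<open>N u \<le> q - 1\<close>. Passing from \<open>\<sigma>\<close> to \<open>\<tau>\<close> therefore adds time at queue level at least \<open>q\<close>
  and removes time at queue level at most \<open>q - 1\<close>, which is the pathwise inequality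
  \[ \int_0^\tau N + q \sigma \ge \int_0^\sigma N + q \tau + (\sigma - \tau)^+ \]
  of \<open>cycle_delay_exchange\<close>. Under equal finite means the terms with the factor \<open>q\<close> cancel in
  expectation, and a gain of \<open>E (\<sigma> - \<tau>)\<^sup>+\<close> is left. The gain is positive, because
  \<open>\<sigma> \<le> \<tau>\<close> almost surely together with equal means would give \<open>\<sigma> = \<tau>\<close> almost surely, whereas
  \<open>\<sigma> < \<tau>\<close> has positive probability (\<open>average_order_delay_less\<close>).

  The argument is the same for both policies. The Poisson law enters through two facts: every count
  has positive probability at every positive time, which gives all the strict inequalities, and the
  first arrival has finite mean, which makes the HP2 cycles integrable.
\<close>

section \<open>Integrals over random time intervals\<close>

lemma nn_integral_lborel_upto_ennreal:
  "(\<integral>\<^sup>+ u. indicator {u. 0 \<le> u \<and> ennreal u \<le> x} u \<partial>lborel) = x"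
proof (cases x)
  case (real r)
  then have "{u. 0 \<le> u \<and> ennreal u \<le> x} = {0..r}" by auto
  then show ?thesis using real by simp
next
  case top
  have "{u. 0 \<le> u \<and> ennreal u \<le> x} = {0..}" using top by auto
  moreover have "emeasure lborel {0::real..} = \<infinity>"
  proof (rule ccontr)
    assume "\<not> ?thesis"
    then obtain r where r: "emeasure lborel {0::real..} = ennreal r" "0 \<le> r"
      by (cases "emeasure lborel {0::real..}") auto
    have "emeasure lborel {0..r + 1} \<le> emeasure lborel {0::real..}"
      by (intro emeasure_mono) auto
    with r show False by (auto simp: ennreal_le_iff)
  qed
  ultimately show ?thesis using top by simp
qed

text \<open>The right-hand side is the ceiling of \<open>x\<close>, written as a series so that its expectation is the sum
of the tail probabilities at the integers.\<close>

lemma ennreal_le_suminf_indicator_less: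
  "x \<le> (\<Sum>n. indicator {n. ennreal (real n) < x} n)"
proof (cases x)
  case (real r)
  have eq: "{n. ennreal (real n) < x} = {..<nat \<lceil>r\<rceil>}"
    using real by (auto simp: ennreal_less_iff) linarith+
  have "r \<le> real (nat \<lceil>r\<rceil>)" using real by linarith
  then have "x \<le> ennreal (real (nat \<lceil>r\<rceil>))" using real by (simp add: ennreal_leI)
  also have "\<dots> = (\<Sum>n<nat \<lceil>r\<rceil>. indicator {n. ennreal (real n) < x} n)"
    unfolding eq by (simp add: ennreal_of_nat_eq_real_of_nat)
  also have "\<dots> \<le> (\<Sum>n. indicator {n. ennreal (real n) < x} n)"
    by (intro sum_le_suminf) auto
  finally show ?thesis .
next
  case top
  have "of_nat k \<le> (\<Sum>n. indicator {n. ennreal (real n) < x} n :: ennreal)" for k :: nat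
    using sum_le_suminf[of "\<lambda>n. indicator {n. ennreal (real n) < x} n :: ennreal" "{..<k}"] top
    by simp
  then have "(\<Sum>n. indicator {n. ennreal (real n) < x} n :: ennreal) = \<top>" (is "?s = _")
  proof -
    have "\<not> ?s < \<top>"
    proof
      assume "?s < \<top>"
      then obtain k where "?s < of_nat k" using ennreal_Ex_less_of_nat[of ?s] by auto
      with \<open>\<And>k. of_nat k \<le> ?s\<close> show False by (simp add: leD)
    qed
    then show ?thesis by (simp only: less_top[symmetric] not_not)
  qed
  then show ?thesis by simp
qed

section \<open>Arrival times\<close>

context poisson_process
begin

text \<open>Right-continuity enters only here: a path that is below \<open>n\<close> at time \<open>t\<close> stays constant for a
while, hence the infimum defining the arrival time is strictly later than \<open>t\<close>. Through this
equivalence all later arguments pass between orders and times.\<close>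

lemma less_arrival_time_iff:
  assumes "\<omega> \<in> space M" "0 \<le> t"
  shows "ennreal t < arrival_time N n \<omega> \<longleftrightarrow> N t \<omega> < n"
proof
  assume "ennreal t < arrival_time N n \<omega>"
  moreover have "arrival_time N n \<omega> \<le> ennreal t" if "n \<le> N t \<omega>"
    unfolding arrival_time_def using that assms by (intro INF_lower) auto
  ultimately show "N t \<omega> < n" by (meson leD not_le)
next
  assume less: "N t \<omega> < n"
  have "((\<lambda>u. N u \<omega>) \<longlongrightarrow> N t \<omega>) (at_right t)"
    using right_continuous_path[OF assms] by (simp add: continuous_within)
  then have "\<forall>\<^sub>F u in at_right t. N u \<omega> = N t \<omega>"
    by (simp add: tendsto_discrete)
  then obtain b where b: "t < b" "\<And>u. t < u \<Longrightarrow> u < b \<Longrightarrow> N u \<omega> = N t \<omega>"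
    by (auto simp: eventually_at_right_field)
  have "b \<le> s" if "0 \<le> s" "n \<le> N s \<omega>" for s
  proof (rule ccontr)
    assume "\<not> b \<le> s"
    moreover have "N s \<omega> \<le> N t \<omega>" if "s \<le> t"
      using mono_onD[OF mono_path[OF assms(1)]] that \<open>0 \<le> s\<close> assms by auto
    ultimately show False using b(2)[of s] less that by (cases "s \<le> t") auto
  qed
  then have "ennreal b \<le> arrival_time N n \<omega>"
    unfolding arrival_time_def by (intro INF_greatest) (auto intro: ennreal_leI)
  moreover have "ennreal t < ennreal b" using assms b by (simp add: ennreal_less_iff)
  ultimately show "ennreal t < arrival_time N n \<omega>" by simp
qed

lemma arrival_time_le_iff:
  assumes "\<omega> \<in> space M" "0 \<le> t"
  shows "arrival_time N n \<omega> \<le> ennreal t \<longleftrightarrow> n \<le> N t \<omega>"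
  using less_arrival_time_iff[OF assms] by (meson not_le)

lemma measurable_arrival_time [measurable]: "arrival_time N n \<in> borel_measurable M"
proof (rule borel_measurableI_le)
  fix y :: ennreal
  show "{\<omega> \<in> space M. arrival_time N n \<omega> \<le> y} \<in> sets M"
  proof (cases y)
    case (real r)
    have [measurable]: "N r \<in> measurable M (count_space UNIV)"
      using real by (intro random_variable_N)
    have "{\<omega> \<in> space M. n \<le> N r \<omega>} \<in> sets M" by measurable
    also have "{\<omega> \<in> space M. n \<le> N r \<omega>} = {\<omega> \<in> space M. arrival_time N n \<omega> \<le> y}"
      using real by (auto simp: arrival_time_le_iff)
    finally show ?thesis .
  next
    case top
    then show ?thesis by simp
  qed
qed

text \<open>Writing the count as a sum over arrivals makes it jointly measurable in path and time, since each
arrival time is a measurable function of the path.\<close>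

lemma count_eq_suminf_arrivals:
  assumes "\<omega> \<in> space M" "0 \<le> u"
  shows "of_nat (N u \<omega>) = (\<Sum>n. if arrival_time N (Suc n) \<omega> \<le> ennreal u then 1 else (0::ennreal))"
proof -
  have "(\<Sum>n. if arrival_time N (Suc n) \<omega> \<le> ennreal u then 1 else (0::ennreal))
      = (\<Sum>n<N u \<omega>. if arrival_time N (Suc n) \<omega> \<le> ennreal u then 1 else 0)"
    using assms by (intro suminf_finite) (auto simp: arrival_time_le_iff)
  also have "\<dots> = (\<Sum>n<N u \<omega>. 1)"
    using assms by (intro sum.cong) (auto simp: arrival_time_le_iff)
  finally show ?thesis by simp
qed

lemma cycle_delay_integrand_eq:
  assumes "\<omega> \<in> space M"
  shows "of_nat (N u \<omega>) * indicator {u. 0 \<le> u \<and> ennreal u \<le> \<tau> \<omega>} u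
    = (\<Sum>n. if arrival_time N (Suc n) \<omega> \<le> ennreal u then 1 else (0::ennreal))
        * (if 0 \<le> u \<and> ennreal u \<le> \<tau> \<omega> then 1 else 0)"
  using assms by (simp add: count_eq_suminf_arrivals)

lemma measurable_cycle_delay_integrand:
  assumes "\<omega> \<in> space M"
  shows "(\<lambda>u. of_nat (N u \<omega>) * indicator {u. 0 \<le> u \<and> ennreal u \<le> x} u :: ennreal)
    \<in> borel_measurable lborel"
  unfolding cycle_delay_integrand_eq[OF assms, of _ "\<lambda>_. x"] by measurable

lemma measurable_cycle_delay:
  assumes [measurable]: "\<tau> \<in> borel_measurable M"
  shows "cycle_delay N \<tau> \<in> borel_measurable M"
proof -
  have "(\<lambda>\<omega>. \<integral>\<^sup>+ u. (\<Sum>n. if arrival_time N (Suc n) \<omega> \<le> ennreal u then 1 else (0::ennreal))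
        * (if 0 \<le> u \<and> ennreal u \<le> \<tau> \<omega> then 1 else 0) \<partial>lborel) \<in> borel_measurable M"
    by measurable
  then show ?thesis
    by (rule measurable_cong[THEN iffD1, rotated])
      (simp add: cycle_delay_def cycle_delay_integrand_eq)
qed

section \<open>The pathwise exchange inequality\<close>

text \<open>The two hypotheses give the integrand inequality at every time except \<open>u = \<sigma> \<omega>\<close>, where the count
may already have jumped to \<open>q\<close>; a single time is negligible for the integral. The difference
\<open>\<sigma> \<omega> - \<tau> \<omega>\<close> is truncated at 0 and comes from the gap between \<open>q\<close> and \<open>q - 1\<close>.\<close>

lemma cycle_delay_exchange:
  assumes \<omega>: "\<omega> \<in> space M"
    and below: "\<And>u. 0 \<le> u \<Longrightarrow> ennreal u < \<sigma> \<omega> \<Longrightarrow> N u \<omega> < q"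
    and above: "\<And>u. 0 \<le> u \<Longrightarrow> \<sigma> \<omega> < ennreal u \<Longrightarrow> ennreal u \<le> \<tau> \<omega> \<Longrightarrow> q \<le> N u \<omega>"
  shows "cycle_delay N \<sigma> \<omega> + of_nat q * \<tau> \<omega> + (\<sigma> \<omega> - \<tau> \<omega>)
    \<le> cycle_delay N \<tau> \<omega> + of_nat q * \<sigma> \<omega>"
proof (cases "\<sigma> \<omega> = \<infinity>")
  case True
  \<comment> \<open>Here \<open>\<sigma> \<omega> - \<tau> \<omega>\<close> may be the artificial value \<open>\<infinity> - \<infinity> = \<infinity>\<close>, but the right-hand side is
    infinite as well: a cycle of positive length forces \<open>q > 0\<close>.\<close>
  then have "0 < q" using below[of 0] by simp
  then show ?thesis using True by (simp add: ennreal_mult_top)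
next
  case finite: False
  define I :: "ennreal \<Rightarrow> real \<Rightarrow> ennreal" where "I = (\<lambda>x. indicator {u. 0 \<le> u \<and> ennreal u \<le> x})"
  define F :: "real \<Rightarrow> ennreal" where "F = (\<lambda>u. of_nat (N u \<omega>))"
  have [measurable]: "I x \<in> borel_measurable lborel" for x
    unfolding I_def by measurable
  have [measurable]: "(\<lambda>u. F u * I x u) \<in> borel_measurable lborel" for x
    unfolding F_def I_def by (rule measurable_cycle_delay_integrand[OF \<omega>])
  have delay: "cycle_delay N \<rho> \<omega> = (\<integral>\<^sup>+ u. F u * I (\<rho> \<omega>) u \<partial>lborel)" for \<rho>
    unfolding cycle_delay_def F_def I_def ..
  have len: "(\<integral>\<^sup>+ u. I x u \<partial>lborel) = x" for x
    unfolding I_def by (rule nn_integral_lborel_upto_ennreal)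
  have "AE u in lborel. u \<noteq> enn2real (\<sigma> \<omega>)" by (rule AE_lborel_singleton)
  then have pointwise: "AE u in lborel.
      F u * I (\<sigma> \<omega>) u + of_nat q * I (\<tau> \<omega>) u + (I (\<sigma> \<omega>) u - I (\<tau> \<omega>) u)
        \<le> F u * I (\<tau> \<omega>) u + of_nat q * I (\<sigma> \<omega>) u"
  proof eventually_elim
    case (elim u)
    consider "u < 0" | "0 \<le> u" "ennreal u < \<sigma> \<omega>" | "0 \<le> u" "\<sigma> \<omega> < ennreal u"
    proof (cases "u < 0")
      case False
      have "ennreal u \<noteq> \<sigma> \<omega>"
      proof
        assume "ennreal u = \<sigma> \<omega>"
        then have "enn2real (\<sigma> \<omega>) = enn2real (ennreal u)" by simp
        also have "\<dots> = u" using False by simp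
        finally show False using elim by simp
      qed
      with False that(2,3) show thesis by (auto simp: not_less neq_iff)
    qed (use that in blast)
    then show ?case
    proof cases
      case 1
      then show ?thesis by (simp add: I_def)
    next
      case 2
      have "of_nat (Suc (N u \<omega>)) \<le> (of_nat q :: ennreal)"
        using below[OF 2] by (intro of_nat_mono) simp
      then have "F u + 1 \<le> of_nat q" by (simp add: F_def add.commute)
      then show ?thesis
        using 2 by (cases "ennreal u \<le> \<tau> \<omega>") (simp_all add: I_def less_imp_le)
    next
      case 3
      have "of_nat q \<le> F u" if "ennreal u \<le> \<tau> \<omega>"
        using above[OF 3 that] unfolding F_def by (rule of_nat_mono)
      then show ?thesis
        using 3 by (cases "ennreal u \<le> \<tau> \<omega>") (simp_all add: I_def leD)
    qed
  qed
  have "\<sigma> \<omega> - \<tau> \<omega> \<le> (\<integral>\<^sup>+ u. I (\<sigma> \<omega>) u - I (\<tau> \<omega>) u \<partial>lborel)"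
  proof -
    have "(\<integral>\<^sup>+ u. I (\<sigma> \<omega>) u \<partial>lborel)
        \<le> (\<integral>\<^sup>+ u. I (\<tau> \<omega>) u + (I (\<sigma> \<omega>) u - I (\<tau> \<omega>) u) \<partial>lborel)"
      by (intro nn_integral_mono) (auto simp: I_def indicator_def)
    also have "\<dots> = \<tau> \<omega> + (\<integral>\<^sup>+ u. I (\<sigma> \<omega>) u - I (\<tau> \<omega>) u \<partial>lborel)"
      by (simp add: nn_integral_add len)
    finally show ?thesis
      by (simp add: ennreal_minus_le_iff len finite[simplified])
  qed
  then have "cycle_delay N \<sigma> \<omega> + of_nat q * \<tau> \<omega> + (\<sigma> \<omega> - \<tau> \<omega>)
    \<le> (\<integral>\<^sup>+ u. F u * I (\<sigma> \<omega>) u \<partial>lborel) + (\<integral>\<^sup>+ u. of_nat q * I (\<tau> \<omega>) u \<partial>lborel)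
       + (\<integral>\<^sup>+ u. I (\<sigma> \<omega>) u - I (\<tau> \<omega>) u \<partial>lborel)"
    by (simp add: delay nn_integral_cmult len add_left_mono)
  also have "\<dots> = (\<integral>\<^sup>+ u. F u * I (\<sigma> \<omega>) u + of_nat q * I (\<tau> \<omega>) u + (I (\<sigma> \<omega>) u - I (\<tau> \<omega>) u) \<partial>lborel)"
    by (simp add: nn_integral_add)
  also have "\<dots> \<le> (\<integral>\<^sup>+ u. F u * I (\<tau> \<omega>) u + of_nat q * I (\<sigma> \<omega>) u \<partial>lborel)"
    by (rule nn_integral_mono_AE[OF pointwise])
  also have "\<dots> = cycle_delay N \<tau> \<omega> + of_nat q * \<sigma> \<omega>"
    by (simp add: delay nn_integral_add nn_integral_cmult len)
  finally show ?thesis .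
qed

section \<open>Positive probabilities and finite means\<close>

lemma emeasure_count_eq:
  assumes "0 < t"
  shows "emeasure M {\<omega> \<in> space M. N t \<omega> = n} = ennreal (pmf (poisson_pmf (lam * t)) n)"
proof -
  have [measurable]: "N t \<in> measurable M (count_space UNIV)"
    using assms by (intro random_variable_N) auto
  have "distr M (count_space UNIV) (N t) = distr M (count_space UNIV) (\<lambda>\<omega>. N t \<omega> - N 0 \<omega>)"
    by (intro distr_cong) (auto simp: N_0)
  also have "\<dots> = measure_pmf (poisson_pmf (lam * t))"
    using poisson_increments[of 0 t] assms by simp
  finally have "emeasure (distr M (count_space UNIV) (N t)) {n} = ennreal (pmf (poisson_pmf (lam * t)) n)"
    by (simp add: emeasure_pmf_single)
  moreover have "emeasure (distr M (count_space UNIV) (N t)) {n} = emeasure M {\<omega> \<in> space M. N t \<omega> = n}"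
    by (subst emeasure_distr) (auto intro!: arg_cong2[where f=emeasure])
  ultimately show ?thesis by simp
qed

text \<open>All strictness in the comparison comes from this: a property that fails on the event \<open>N t = n\<close>
fails with positive probability, because a Poisson variable charges every natural number.\<close>

lemma not_AE_if_count_eq:
  assumes "0 < t" and "\<And>\<omega>. \<omega> \<in> space M \<Longrightarrow> N t \<omega> = n \<Longrightarrow> \<not> P \<omega>"
  shows "\<not> (AE \<omega> in M. P \<omega>)"
proof
  assume "AE \<omega> in M. P \<omega>"
  then have "AE \<omega> in M. N t \<omega> \<noteq> n" using AE_space by eventually_elim (use assms in auto)
  moreover have "{\<omega> \<in> space M. N t \<omega> = n} \<in> sets M"
    using random_variable_N[OF less_imp_le[OF assms(1)]] by measurable
  ultimately have "emeasure M {\<omega> \<in> space M. N t \<omega> = n} = 0"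
    by (subst (asm) AE_iff_measurable[OF _ refl]) auto
  moreover have "0 < pmf (poisson_pmf (lam * t)) n" using assms(1) rate_pos by simp
  ultimately show False using emeasure_count_eq[OF assms(1), of n] by simp
qed

text \<open>The tails at the integers are \<open>exp (- lam * n)\<close>, so the mean is bounded by a geometric series.\<close>

lemma expected_first_arrival_finite: "(\<integral>\<^sup>+ \<omega>. arrival_time N 1 \<omega> \<partial>M) < \<infinity>"
proof -
  have no_arrival: "emeasure M {\<omega> \<in> space M. ennreal (real n) < arrival_time N 1 \<omega>}
      \<le> ennreal (exp (- lam) ^ n)" for n
  proof (cases "n = 0")
    case True
    then show ?thesis using emeasure_le_1 by simp
  next
    case False
    have "{\<omega> \<in> space M. ennreal (real n) < arrival_time N 1 \<omega>} = {\<omega> \<in> space M. N (real n) \<omega> = 0}"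
      by (auto simp: less_arrival_time_iff)
    then show ?thesis
      using False emeasure_count_eq[of "real n" 0] rate_pos
      by (simp add: exp_of_nat_mult[symmetric] mult.commute[of lam])
  qed
  have "(\<integral>\<^sup>+ \<omega>. arrival_time N 1 \<omega> \<partial>M)
      \<le> (\<integral>\<^sup>+ \<omega>. (\<Sum>n. indicator {\<omega> \<in> space M. ennreal (real n) < arrival_time N 1 \<omega>} \<omega>) \<partial>M)"
  proof (rule nn_integral_mono)
    fix \<omega> assume "\<omega> \<in> space M"
    then show "arrival_time N 1 \<omega>
        \<le> (\<Sum>n. indicator {\<omega> \<in> space M. ennreal (real n) < arrival_time N 1 \<omega>} \<omega>)"
      using ennreal_le_suminf_indicator_less[of "arrival_time N 1 \<omega>"]
      by (simp add: indicator_def)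
  qed
  also have "\<dots> = (\<Sum>n. emeasure M {\<omega> \<in> space M. ennreal (real n) < arrival_time N 1 \<omega>})"
    by (subst nn_integral_suminf) auto
  also have "\<dots> \<le> (\<Sum>n. ennreal (exp (- lam) ^ n))"
    using no_arrival by (intro suminf_le) auto
  also have "\<dots> = ennreal (\<Sum>n. exp (- lam) ^ n)"
    using rate_pos by (intro suminf_ennreal2 summable_geometric) auto
  also have "\<dots> < \<infinity>" by simp
  finally show ?thesis .
qed

section \<open>Comparison of policies with equal mean cycle length\<close>

text \<open>In expectation the terms \<open>q * E \<sigma>\<close> and \<open>q * E \<tau>\<close> of the exchange inequality cancel, which
needs finiteness of the common mean; what remains is the gain \<open>E (\<sigma> - \<tau>)\<^sup>+\<close>.\<close>

lemma average_order_delay_less: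
  assumes [measurable]: "\<sigma> \<in> borel_measurable M" "\<tau> \<in> borel_measurable M"
    and mean: "expected_cycle_length M \<sigma> = expected_cycle_length M \<tau>"
    and fin: "expected_cycle_length M \<sigma> < \<infinity>"
    and below: "\<And>\<omega> u. \<omega> \<in> space M \<Longrightarrow> 0 \<le> u \<Longrightarrow> ennreal u < \<sigma> \<omega> \<Longrightarrow> N u \<omega> < q"
    and above: "\<And>\<omega> u. \<omega> \<in> space M \<Longrightarrow> 0 \<le> u \<Longrightarrow> \<sigma> \<omega> < ennreal u \<Longrightarrow> ennreal u \<le> \<tau> \<omega>
      \<Longrightarrow> q \<le> N u \<omega>"
    and later: "\<not> (AE \<omega> in M. \<tau> \<omega> \<le> \<sigma> \<omega>)"
  shows "average_order_delay M lam N \<sigma> < average_order_delay M lam N \<tau>"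
proof -
  define m where "m = expected_cycle_length M \<sigma>"
  have m: "(\<integral>\<^sup>+ \<omega>. \<sigma> \<omega> \<partial>M) = m" "(\<integral>\<^sup>+ \<omega>. \<tau> \<omega> \<partial>M) = m" "m < \<infinity>"
    using mean fin by (auto simp: m_def expected_cycle_length_def)
  have "0 < m"
  proof (rule ccontr)
    assume "\<not> 0 < m"
    then have "AE \<omega> in M. \<tau> \<omega> = 0"
      using m(2) nn_integral_0_iff_AE[of \<tau> M] by simp
    then have "AE \<omega> in M. \<tau> \<omega> \<le> \<sigma> \<omega>" by eventually_elim simp
    with later show False by contradiction
  qed
  note [measurable] = measurable_cycle_delay[OF assms(1)] measurable_cycle_delay[OF assms(2)]
  define d where "d = (\<lambda>\<rho>. \<integral>\<^sup>+ \<omega>. cycle_delay N \<rho> \<omega> \<partial>M)"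
  define \<delta> where "\<delta> = (\<integral>\<^sup>+ \<omega>. \<sigma> \<omega> - \<tau> \<omega> \<partial>M)"
  have exchange: "d \<sigma> + of_nat q * m + \<delta> \<le> d \<tau> + of_nat q * m"
  proof -
    have "d \<sigma> + of_nat q * m + \<delta>
        = (\<integral>\<^sup>+ \<omega>. cycle_delay N \<sigma> \<omega> + of_nat q * \<tau> \<omega> + (\<sigma> \<omega> - \<tau> \<omega>) \<partial>M)"
      unfolding d_def \<delta>_def by (simp add: nn_integral_add nn_integral_cmult m)
    also have "\<dots> \<le> (\<integral>\<^sup>+ \<omega>. cycle_delay N \<tau> \<omega> + of_nat q * \<sigma> \<omega> \<partial>M)"
      using below above by (intro nn_integral_mono cycle_delay_exchange) auto
    also have "\<dots> = d \<tau> + of_nat q * m"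
      unfolding d_def by (simp add: nn_integral_add nn_integral_cmult m)
    finally show ?thesis .
  qed
  have "of_nat q * m < \<infinity>" using m(3) by (simp add: ennreal_mult_less_top of_nat_less_top)
  then have gain: "d \<sigma> + \<delta> \<le> d \<tau>"
    using exchange ennreal_add_left_cancel_le[of "of_nat q * m" "d \<sigma> + \<delta>" "d \<tau>"]
    by (auto simp: ac_simps)
  have "0 < \<delta>"
  proof (rule ccontr)
    assume "\<not> 0 < \<delta>"
    then have "AE \<omega> in M. \<sigma> \<omega> - \<tau> \<omega> = 0"
      using nn_integral_0_iff_AE[of "\<lambda>\<omega>. \<sigma> \<omega> - \<tau> \<omega>" M] by (simp add: \<delta>_def)
    then have "AE \<omega> in M. \<sigma> \<omega> \<le> \<tau> \<omega>" by eventually_elim (rule ennreal_minus_eq_0)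
    then have "(\<integral>\<^sup>+ \<omega>. \<sigma> \<omega> \<partial>M) < (\<integral>\<^sup>+ \<omega>. \<tau> \<omega> \<partial>M)"
      using later m by (intro nn_integral_less) auto
    then show False using m by simp
  qed
  have "d \<sigma> < \<infinity>"
  proof -
    \<comment> \<open>At most \<open>q\<close> orders wait at any time of the cycle: exchange with the cycle of length 0.\<close>
    have "cycle_delay N \<sigma> \<omega> \<le> of_nat q * \<sigma> \<omega>" if "\<omega> \<in> space M" for \<omega>
    proof -
      have "{u. 0 \<le> u \<and> ennreal u \<le> 0} = {0}" by auto
      then have "cycle_delay N (\<lambda>_. 0) \<omega> = 0"
        by (simp add: cycle_delay_def nn_integral_indicator_singleton)
      moreover have "cycle_delay N \<sigma> \<omega> + of_nat q * 0 + (\<sigma> \<omega> - 0)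
          \<le> cycle_delay N (\<lambda>_. 0) \<omega> + of_nat q * \<sigma> \<omega>"
        using below[OF that] by (intro cycle_delay_exchange[OF that]) auto
      ultimately have "cycle_delay N \<sigma> \<omega> + \<sigma> \<omega> \<le> of_nat q * \<sigma> \<omega>" by simp
      then show ?thesis by (rule order_trans[rotated]) simp
    qed
    then have "d \<sigma> \<le> of_nat q * m"
      unfolding d_def m(1)[symmetric] by (subst nn_integral_cmult[symmetric]) (auto intro: nn_integral_mono)
    then show ?thesis using \<open>of_nat q * m < \<infinity>\<close> by simp
  qed
  then have "d \<sigma> + 0 < d \<sigma> + \<delta>"
    using \<open>0 < \<delta>\<close> by (simp only: ennreal_add_left_cancel_less) simp
  from less_le_trans[OF this gain] have "d \<sigma> < d \<tau>" by simp
  moreover have "0 < ennreal lam * m" "ennreal lam * m < \<infinity>"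
    using rate_pos \<open>0 < m\<close> m(3) by (auto simp: ennreal_zero_less_mult_iff ennreal_mult_less_top)
  ultimately have "d \<sigma> / (ennreal lam * m) < d \<tau> / (ennreal lam * m)"
    unfolding divide_ennreal_def
    by (intro ennreal_mult_strict_right_mono) (auto simp: ennreal_inverse_positive less_top[symmetric])
  then show ?thesis
    unfolding average_order_delay_def d_def mean[symmetric] m_def .
qed

lemma arrival_time_mono: "m \<le> n \<Longrightarrow> arrival_time N m \<omega> \<le> arrival_time N n \<omega>"
  unfolding arrival_time_def by (intro INF_superset_mono) auto

text \<open>At equal finite means, no cycle can be pathwise at least as long as the other and longer with positive
probability. For HP1 and HP2 this compels the policy with the larger quantity parameter to have
the smaller time parameter.\<close>

lemma time_parameter_less:
  assumes [measurable]: "\<sigma> \<in> borel_measurable M" "\<tau> \<in> borel_measurable M"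
    and mean: "expected_cycle_length M \<sigma> = expected_cycle_length M \<tau>"
    and fin: "expected_cycle_length M \<sigma> < \<infinity>"
    and later: "\<not> (AE \<omega> in M. \<tau> \<omega> \<le> \<sigma> \<omega>)"
    and le: "(T::real) \<le> T' \<Longrightarrow> (\<And>\<omega>. \<sigma> \<omega> \<le> \<tau> \<omega>)"
  shows "T' < T"
proof (rule ccontr)
  assume "\<not> T' < T"
  then have "(\<integral>\<^sup>+ \<omega>. \<sigma> \<omega> \<partial>M) < (\<integral>\<^sup>+ \<omega>. \<tau> \<omega> \<partial>M)"
    using later fin le by (intro nn_integral_less) (auto simp: expected_cycle_length_def)
  then show False using mean by (simp add: expected_cycle_length_def)
qed

lemma HP1_average_order_delay_less:
  assumes "q < q'" "0 < T'"
    and mean: "expected_cycle_length M (HP1 N q T) = expected_cycle_length M (HP1 N q' T')"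
  shows "average_order_delay M lam N (HP1 N q T) < average_order_delay M lam N (HP1 N q' T')"
proof -
  have meas: "HP1 N n x \<in> borel_measurable M" for n x
    unfolding HP1_def[abs_def] by measurable
  have "expected_cycle_length M (HP1 N q T) \<le> (\<integral>\<^sup>+ \<omega>. ennreal T \<partial>M)"
    unfolding expected_cycle_length_def HP1_def by (intro nn_integral_mono) auto
  also have "\<dots> < \<infinity>" by (simp add: emeasure_space_1)
  finally have fin: "expected_cycle_length M (HP1 N q T) < \<infinity>" .
  \<comment> \<open>With exactly \<open>q\<close> orders at time \<open>T' / 2\<close>, the first cycle is over and the second one still
    waits both for order \<open>q'\<close> and for its clock.\<close>
  have later: "\<not> (AE \<omega> in M. HP1 N q' T' \<omega> \<le> HP1 N q T \<omega>)"
  proof (rule not_AE_if_count_eq[of "T' / 2" q])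
    fix \<omega> assume \<omega>: "\<omega> \<in> space M" "N (T' / 2) \<omega> = q"
    have "HP1 N q T \<omega> \<le> ennreal (T' / 2)"
      using \<omega> assms by (auto simp: HP1_def min_le_iff_disj arrival_time_le_iff)
    also have "\<dots> < HP1 N q' T' \<omega>"
      using \<omega> assms by (simp add: HP1_def less_arrival_time_iff ennreal_less_iff)
    finally show "\<not> HP1 N q' T' \<omega> \<le> HP1 N q T \<omega>" by simp
  qed (use assms in simp)
  have "T' < T"
    using assms by (intro time_parameter_less[OF meas meas mean fin later])
      (simp_all only: HP1_def, intro min.mono arrival_time_mono ennreal_leI, simp_all)
  show ?thesis
  proof (rule average_order_delay_less[OF meas meas mean fin _ _ later])
    fix \<omega> and u :: real assume \<omega>: "\<omega> \<in> space M" "0 \<le> u"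
    show "N u \<omega> < q" if "ennreal u < HP1 N q T \<omega>"
      using that \<omega> by (simp add: HP1_def less_arrival_time_iff)
    show "q \<le> N u \<omega>" if "HP1 N q T \<omega> < ennreal u" "ennreal u \<le> HP1 N q' T' \<omega>"
    proof -
      have "ennreal u \<le> ennreal T'" using that(2) by (simp add: HP1_def)
      then have "u \<le> T'" using assms by (simp add: ennreal_le_iff)
      then have "arrival_time N q \<omega> < ennreal u"
        using that(1) \<open>T' < T\<close> \<omega> by (simp add: HP1_def min_less_iff_disj ennreal_less_iff)
      then show ?thesis using \<omega> by (simp add: arrival_time_le_iff[symmetric] less_imp_le)
    qed
  qed
qed

lemma HP2_average_order_delay_less:
  assumes "q < q'" "0 < T'"
    and mean: "expected_cycle_length M (HP2 N q T) = expected_cycle_length M (HP2 N q' T')"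
  shows "average_order_delay M lam N (HP2 N q T) < average_order_delay M lam N (HP2 N q' T')"
proof -
  have meas: "HP2 N n x \<in> borel_measurable M" for n x
    unfolding HP2_def[abs_def] by measurable
  have "expected_cycle_length M (HP2 N q T) \<le> (\<integral>\<^sup>+ \<omega>. arrival_time N 1 \<omega> + ennreal T \<partial>M)"
    unfolding expected_cycle_length_def HP2_def by (intro nn_integral_mono) auto
  also have "\<dots> < \<infinity>"
    using expected_first_arrival_finite by (simp add: nn_integral_add emeasure_space_1)
  finally have fin: "expected_cycle_length M (HP2 N q T) < \<infinity>" .
  \<comment> \<open>With exactly \<open>q\<close> orders at time \<open>T' / 2\<close>, the first cycle is over and the second one still
    waits both for order \<open>q'\<close> and for its clock.\<close>
  have later: "\<not> (AE \<omega> in M. HP2 N q' T' \<omega> \<le> HP2 N q T \<omega>)"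
  proof (rule not_AE_if_count_eq[of "T' / 2" q])
    fix \<omega> assume \<omega>: "\<omega> \<in> space M" "N (T' / 2) \<omega> = q"
    have "HP2 N q T \<omega> \<le> ennreal (T' / 2)"
      using \<omega> assms by (auto simp: HP2_def min_le_iff_disj arrival_time_le_iff)
    also have "ennreal (T' / 2) < HP2 N q' T' \<omega>"
    proof -
      have "ennreal (T' / 2) < ennreal T'" using assms by (simp add: ennreal_less_iff)
      also have "\<dots> \<le> arrival_time N 1 \<omega> + ennreal T'" by simp
      finally show ?thesis using \<omega> assms by (simp add: HP2_def less_arrival_time_iff)
    qed
    finally show "\<not> HP2 N q' T' \<omega> \<le> HP2 N q T \<omega>" by simp
  qed (use assms in simp)
  have "T' < T"
    using assms by (intro time_parameter_less[OF meas meas mean fin later])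
      (simp_all only: HP2_def, intro min.mono arrival_time_mono ennreal_leI add_left_mono, simp_all)
  show ?thesis
  proof (rule average_order_delay_less[OF meas meas mean fin _ _ later])
    fix \<omega> and u :: real assume \<omega>: "\<omega> \<in> space M" "0 \<le> u"
    show "N u \<omega> < q" if "ennreal u < HP2 N q T \<omega>"
      using that \<omega> by (simp add: HP2_def less_arrival_time_iff)
    show "q \<le> N u \<omega>" if "HP2 N q T \<omega> < ennreal u" "ennreal u \<le> HP2 N q' T' \<omega>"
    proof -
      have "ennreal u \<le> arrival_time N 1 \<omega> + ennreal T'" using that(2) by (simp add: HP2_def)
      also have "\<dots> \<le> arrival_time N 1 \<omega> + ennreal T"
        using \<open>T' < T\<close> by (intro add_left_mono ennreal_leI) simp
      finally have "arrival_time N q \<omega> < ennreal u"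
        using that(1) by (auto simp: HP2_def min_less_iff_disj)
      then show ?thesis using \<omega> by (simp add: arrival_time_le_iff[symmetric] less_imp_le)
    qed
  qed
qed

end

theorem theorem5p5:
  fixes M :: "'a measure" and lam :: real and N :: "real \<Rightarrow> 'a \<Rightarrow> nat"
    and q q' :: nat and T T' :: real
  assumes "poisson_process M lam N"
    and "1 \<le> q" and "q < q'"
    and "0 < T" and "0 < T'"
  shows "(expected_cycle_length M (HP1 N q T) = expected_cycle_length M (HP1 N q' T') \<longrightarrow>
            average_order_delay M lam N (HP1 N q T) < average_order_delay M lam N (HP1 N q' T')) \<and>
         (expected_cycle_length M (HP2 N q T) = expected_cycle_length M (HP2 N q' T') \<longrightarrow>
            average_order_delay M lam N (HP2 N q T) < average_order_delay M lam N (HP2 N q' T'))"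
proof -
  interpret poisson_process M lam N by fact
  show ?thesis
    using HP1_average_order_delay_less HP2_average_order_delay_less assms by blast
qed

end
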